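(* Let $a<b$ be real numbers and let $h,g:[a,b)\to\mathbb{R}$ be continuous functions such that $h$ is increasing and is not constant on any neighborhood of $a$, and suppose the limit $\lim_{x\to a}\frac{g(x)-g(a)}{h(x)-h(a)}$ exists and is finite. For $x\in(a,b)$ let $\mu(x)$ be the supremum of the set of numbers $\tau\in(a,x]$ that are points of local extremum of the function $t\mapsto \bigl(g(x)-g(a)\bigr)h(t)-\bigl(h(x)-h(a)\bigr)g(t)$, $t\in[a,b)$. Let $$C=\overline{\lim_{x\to a}}\operatorname{ess}\frac{h(x)-h(a)}{(x-a)\,h'(x)}\in[0,+\infty].$$ Then $$\varlimsup_{x\to a}\frac{\mu(x)-a}{x-a}\ \geq\ e^{-C}.$$ If, in addition, $h$ and $g$ are differentiable on $(a,b)$ with $h'(t)>0$ for all $t\in(a,b)$, and for $x\in(a,b)$ $\xi(x)$ denotes the supremum of the numbers $\tau\in(a,x)$ with $\frac{g(x)-g(a)}{h(x)-h(a)}=\frac{g'(\tau)}{h'(\tau)}$, then also $$\varlimsup_{x\to a}\frac{\xi(x)-a}{x-a}\ \geq\ e^{-C}.$$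
   Context: An increasing function is differentiable almost everywhere, so $h'(x)$ is defined for almost all $x$. For a function $f$ defined almost everywhere on $[a,b)$, the essential upper limit $\overline{\lim_{x\to a}}\operatorname{ess} f(x)$ is the greatest lower bound of the numbers $t\in\mathbb{R}$ such that $f(x)\le t$ for almost all $x$ in some interval $[a,\delta]\subset[a,b)$ (it equals $+\infty$ if there is no such $t$). The convention $e^{-\infty}=0$ is used. Limits at $a$ are right-hand limits. *)

theory Defs
  imports "HOL-Analysis.Analysis"
begin

definition local_extremum_on :: "real set \<Rightarrow> (real \<Rightarrow> real) \<Rightarrow> real \<Rightarrow> bool" where
  "local_extremum_on S phi tau \<longleftrightarrow> tau \<in> S \<and>
     (\<exists>e>0. (\<forall>t\<in>S. \<bar>t - tau\<bar> < e \<longrightarrow> phi t \<le> phi tau) \<or>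
            (\<forall>t\<in>S. \<bar>t - tau\<bar> < e \<longrightarrow> phi tau \<le> phi t))"

definition mu_fun :: "real \<Rightarrow> real \<Rightarrow> (real \<Rightarrow> real) \<Rightarrow> (real \<Rightarrow> real) \<Rightarrow> real \<Rightarrow> real" where
  "mu_fun a b h g x = Sup {tau \<in> {a<..x}.
      local_extremum_on {a..<b} (\<lambda>t. (g x - g a) * h t - (h x - h a) * g t) tau}"

definition xi_fun :: "real \<Rightarrow> (real \<Rightarrow> real) \<Rightarrow> (real \<Rightarrow> real) \<Rightarrow> real \<Rightarrow> real" where
  "xi_fun a h g x = Sup {tau \<in> {a<..<x}. (g x - g a) / (h x - h a) = deriv g tau / deriv h tau}"

text \<open>Essential upper limit at a (from the right) of f on [a,b): infimum of the reals t
  such that f x \<le> t for almost all x in some [a,delta] contained in [a,b);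
  +infinity if there is no such t.\<close>
definition ess_limsup_right :: "real \<Rightarrow> real \<Rightarrow> (real \<Rightarrow> ereal) \<Rightarrow> ereal" where
  "ess_limsup_right a b f = Inf (ereal ` {t. \<exists>\<delta>. a < \<delta> \<and> \<delta> < b \<and>
      (AE x in lebesgue. x \<in> {a..\<delta>} \<longrightarrow> f x \<le> ereal t)})"

definition ratio_fun :: "real \<Rightarrow> (real \<Rightarrow> real) \<Rightarrow> real \<Rightarrow> ereal" where
  "ratio_fun a h x = (if deriv h x = 0 then \<infinity> else ereal ((h x - h a) / ((x - a) * deriv h x)))"

definition exp_neg_ereal :: "ereal \<Rightarrow> ereal" where
  "exp_neg_ereal C = (case C of ereal r \<Rightarrow> ereal (exp (- r)) | PInfty \<Rightarrow> 0 | MInfty \<Rightarrow> \<infinity>)"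

end

theory Submission
  imports Defs
begin

text \<open>Let \<open>a = g a = h a = 0\<close>, \<open>\<phi>\<^sub>x t = g x * h t - h x * g t\<close> and \<open>f = g / h\<close>, and suppose
  that \<open>\<mu> x < q x\<close> (or \<open>\<xi> x < q x\<close>) for all small \<open>x > 0\<close>. Two equal values of \<open>\<phi>\<^sub>x\<close> enclose a
  local extremum, so \<open>\<phi>\<^sub>x\<close> is injective on \<open>[q x, x]\<close>.  Hence \<open>f\<close> is locally injective, so strictly
  monotone, say increasing; subtracting a multiple of \<open>h\<close> from \<open>g\<close> we may assume that \<open>f\<close> tends to \<open>0\<close>
  at \<open>0\<close>. Monotonicity of \<open>\<phi>\<^sub>x\<close> then says that \<open>h t * (f t - f x)\<close> increases on \<open>[q x, x]\<close>.
  If \<open>h x \<le> T x h' x\<close> almost everywhere, then \<open>ln h\<close> grows at least as fast as \<open>(ln x) / T\<close>; for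
  \<open>F s = f (exp s)\<close> and \<open>r = - ln q\<close> this gives the delay inequality \<open>F (s + r) - F s \<le> T F' s\<close>.
  Integrating from \<open>- \<infinity>\<close> to \<open>s\<close> yields \<open>r F s \<le> \<integral>\<^bsub>[s, s + r]\<^esub> F \<le> T F s\<close>, that is
  \<open>q \<ge> exp (- T)\<close>. The passage from \<open>h x \<le> T x h' x\<close> to the growth of \<open>ln h\<close> rests on Lebesgue's
  theorem: a monotone continuous function is almost everywhere differentiable
  (points of infinite slope, which do no harm here, need not be excluded).\<close>

section \<open>A discrete delay inequality\<close>

text \<open>Along the mesh \<open>x m = X * p ^ m\<close> with \<open>p ^ (n + 1) = q\<close>, the hypotheses bound
  the increment of \<open>F\<close> over one step from below by \<open>d / T\<close> times its increment over \<open>n\<close> steps,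
  where \<open>d = - ln p\<close>.  Summing over all \<open>m\<close> telescopes on both sides, and leaves
  \<open>F (x n) \<ge> d / T * (F (x 0) + \<dots> + F (x (n - 1))) \<ge> d / T * n * F (x n)\<close>.\<close>
lemma geometric_mesh_bound:
  fixes F H :: "real \<Rightarrow> real" and q T \<delta> :: real
  assumes q: "0 < q" "q < 1" and T: "0 < T" and \<delta>: "0 < \<delta>"
    and pos: "\<And>x. 0 < x \<Longrightarrow> x < \<delta> \<Longrightarrow> 0 < F x"
    and mono: "\<And>x y. 0 < x \<Longrightarrow> x \<le> y \<Longrightarrow> y < \<delta> \<Longrightarrow> F x \<le> F y"
    and lim: "(F \<longlongrightarrow> 0) (at_right 0)"
    and Hpos: "\<And>x. 0 < x \<Longrightarrow> x < \<delta> \<Longrightarrow> 0 < H x"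
    and step: "\<And>x t. 0 < x \<Longrightarrow> x < \<delta> \<Longrightarrow> q * x \<le> t \<Longrightarrow> t \<le> x \<Longrightarrow>
                  H (q * x) * (F (q * x) - F x) \<le> H t * (F t - F x)"
    and growth: "\<And>s t. 0 < s \<Longrightarrow> s < t \<Longrightarrow> t < \<delta> \<Longrightarrow> H s * ((ln t - ln s) / T) \<le> H t - H s"
  shows "- ln q \<le> T"
proof -
  have bound: "- ln q / Suc n * n \<le> T" for n :: nat
  proof -
    define d where "d = - ln q / Suc n"
    define p where "p = exp (- d)"
    \<comment> \<open>The factor \<open>\<delta> / 2\<close> keeps even the starting point
      \<open>X 0\<close> below \<open>\<delta>\<close>.\<close>
    define X where "X m = \<delta> / 2 * p ^ m" for m :: nat
    define e where "e m = F (X m)" for m :: nat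
    have "d > 0" using q by (simp add: d_def field_simps)
    hence p: "0 < p" "p < 1" by (auto simp: p_def)
    have pq: "p ^ Suc n = q"
    proof -
      have "p ^ Suc n = exp (real (Suc n) * - d)" unfolding p_def by (rule exp_of_nat_mult [symmetric])
      also have "real (Suc n) * - d = ln q" unfolding d_def by (simp del: of_nat_Suc)
      finally show ?thesis using q by simp
    qed
    have Xpos: "0 < X m" and Xlt: "X m < \<delta>" for m
    proof -
      show "0 < X m" using p \<delta> by (simp add: X_def)
      have "p ^ m \<le> 1" using p by (simp add: power_le_one)
      hence "\<delta> / 2 * p ^ m \<le> \<delta> / 2 * 1" using \<delta> by (intro mult_left_mono) auto
      thus "X m < \<delta>" using \<delta> by (simp add: X_def)
    qed
    have Xdec: "X m' \<le> X m" if "m \<le> m'" for m m'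
      using p \<delta> that by (auto simp: X_def intro!: mult_left_mono power_decreasing)
    have edec: "e m' \<le> e m" if "m \<le> m'" for m m'
      unfolding e_def by (intro mono Xpos Xlt Xdec that)
    \<comment> \<open>By \<open>growth\<close>, \<open>H\<close> gains at least the factor
      \<open>1 + d / T\<close> from \<open>?s\<close> to the next mesh point \<open>?t\<close>.
      Since \<open>e (m + n) - e m\<close> is nonpositive, replacing \<open>H ?t\<close> by this
      smaller bound weakens \<open>step\<close> correctly, and the positive factor
      \<open>H ?s\<close> cancels.\<close>
    have step_e: "d / T * (e m - e (m + n)) \<le> e (m + n) - e (m + Suc n)" for m
    proof -
      let ?s = "X (m + Suc n)" and ?t = "X (m + n)" and ?x = "X m"
      have s: "?s = q * ?x" using pq by (simp add: X_def power_add mult_ac)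
      have "?s = ?t * p" by (simp add: X_def)
      hence lnd: "ln ?t - ln ?s = d"
        using p Xpos[of "m + n"] by (simp add: ln_mult p_def)
      have "?s < ?t" using \<open>?s = ?t * p\<close> p Xpos[of "m+n"] by simp
      have A: "H ?s * (e (m + Suc n) - e m) \<le> H ?t * (e (m + n) - e m)"
        unfolding e_def using step[of ?x ?t] Xpos Xlt Xdec \<open>?s < ?t\<close> s by auto
      have B: "H ?s * (1 + d / T) \<le> H ?t"
        using growth[of ?s ?t] Xpos Xlt \<open>?s < ?t\<close> lnd by (simp add: algebra_simps)
      have "e (m + n) \<le> e m" by (rule edec) simp
      hence "H ?t * (e (m + n) - e m) \<le> H ?s * (1 + d / T) * (e (m + n) - e m)"
        using B by (intro mult_right_mono_neg) auto
      hence "H ?s * (e (m + Suc n) - e m) \<le> H ?s * ((1 + d / T) * (e (m + n) - e m))"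
        using A by (simp add: mult.assoc)
      hence "e (m + Suc n) - e m \<le> (1 + d / T) * (e (m + n) - e m)"
        using Hpos[OF Xpos Xlt] by (simp only: mult_le_cancel_left_pos)
      thus ?thesis by (simp add: algebra_simps)
    qed
    \<comment> \<open>Both splittings of the sum of the first \<open>M + n\<close> terms, after
      \<open>M\<close> and after \<open>n\<close> terms, are compared.\<close>
    have sums: "(\<Sum>m<M. e m) - (\<Sum>m<M. e (m + n)) = (\<Sum>m<n. e m) - (\<Sum>m<n. e (m + M))" for M
    proof -
      have "(\<Sum>m<M. e m) + (\<Sum>m<n. e (m + M)) = (\<Sum>m<M + n. e m)" for M n
        by (induction n) (auto simp: add_ac)
      from this[of M n] this[of n M] show ?thesis by (simp add: add_ac)
    qed
    have main: "d / T * (n * e n - n * e M) \<le> e n - e (M + n)" for M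
    proof -
      have "n * e n \<le> (\<Sum>m<n. e m)"
        using sum_bounded_below[of "{..<n}" "e n" e] edec by simp
      moreover have "(\<Sum>m<n. e (m + M)) \<le> n * e M"
        using sum_bounded_above[of "{..<n}" "\<lambda>m. e (m + M)" "e M"] edec by simp
      ultimately have "d / T * (n * e n - n * e M) \<le> d / T * ((\<Sum>m<M. e m) - (\<Sum>m<M. e (m + n)))"
        using \<open>d > 0\<close> T by (intro mult_left_mono) (auto simp: sums)
      also have "\<dots> = (\<Sum>m<M. d / T * (e m - e (m + n)))"
        by (simp only: sum_subtractf [symmetric] sum_distrib_left)
      also have "\<dots> \<le> (\<Sum>m<M. e (m + n) - e (Suc m + n))"
        using step_e by (intro sum_mono) simp
      also have "\<dots> = e n - e (M + n)"
        using sum_lessThan_telescope'[of "\<lambda>m. e (m + n)" M] by simp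
      finally show ?thesis .
    qed
    have X0: "X \<longlonglongrightarrow> 0"
      unfolding X_def using p by (intro tendsto_mult_right_zero LIMSEQ_power_zero) auto
    moreover have "X m \<in> {0<..} \<and> X m \<noteq> 0" for m
      using Xpos[of m] by simp
    ultimately have "filterlim X (at_right 0) sequentially"
      by (auto simp: filterlim_at)
    hence e0: "e \<longlonglongrightarrow> 0"
      unfolding e_def by (rule filterlim_compose[OF lim])
    have "(\<lambda>M. d / T * (n * e n - n * e M)) \<longlonglongrightarrow> d / T * (n * e n - n * (0::real))"
      by (rule tendsto_intros e0)+
    moreover have "(\<lambda>M. e n - e (M + n)) \<longlonglongrightarrow> e n - 0"
      by (intro tendsto_intros LIMSEQ_ignore_initial_segment e0)
    ultimately have "d / T * (n * e n - n * (0::real)) \<le> e n - 0"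
      by (rule LIMSEQ_le) (use main in blast)
    hence "e n * (d / T * n) \<le> e n * 1" by (simp add: mult_ac)
    moreover have "e n > 0" unfolding e_def by (intro pos Xpos Xlt)
    ultimately have "d / T * n \<le> 1" by (simp only: mult_le_cancel_left_pos)
    hence "d * n \<le> T" using T by (simp add: field_simps)
    thus ?thesis by (simp add: d_def)
  qed
  \<comment> \<open>The delay covers only \<open>n\<close> of the \<open>n + 1\<close> mesh steps
    between \<open>x\<close> and \<open>q * x\<close>. The resulting loss, a factor
    \<open>n / (n + 1)\<close>, disappears as the mesh is refined.\<close>
  have "(\<lambda>n. - ln q / Suc n * n) \<longlonglongrightarrow> - ln q"
  proof -
    have "(\<lambda>n. - ln q * (n / Suc n)) \<longlonglongrightarrow> - ln q * 1"
      by (intro tendsto_intros LIMSEQ_n_over_Suc_n)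
    thus ?thesis by (simp add: field_simps)
  qed
  thus ?thesis using bound by (intro LIMSEQ_le_const2) auto
qed

section \<open>From injectivity on short intervals to monotonicity of the ratio\<close>

lemma local_extremum_between:
  fixes f :: "real \<Rightarrow> real"
  assumes st: "s < t" and cont: "continuous_on {s..t} f" and eq: "f s = f t"
  obtains c where "s < c" "c < t" "(\<forall>u\<in>{s..t}. f u \<le> f c) \<or> (\<forall>u\<in>{s..t}. f c \<le> f u)"
proof -
  obtain M where M: "M \<in> {s..t}" "\<forall>u\<in>{s..t}. f u \<le> f M"
    using continuous_attains_sup[OF compact_Icc _ cont] st by auto
  obtain m where m: "m \<in> {s..t}" "\<forall>u\<in>{s..t}. f m \<le> f u"
    using continuous_attains_inf[OF compact_Icc _ cont] st by auto
  consider "s < M" "M < t" | "s < m" "m < t" | "f M = f s" "f m = f s"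
    using M(1) m(1) eq by fastforce
  thus thesis
  proof cases
    \<comment> \<open>Here maximum and minimum both equal the endpoint value, so \<open>f\<close> is
      constant and any interior point serves.\<close>
    case 3
    have "\<forall>u\<in>{s..t}. f u \<le> f ((s + t) / 2)"
    proof
      fix u assume "u \<in> {s..t}"
      hence "f u \<le> f M" using M by auto
      also have "\<dots> = f m" using 3 by simp
      also have "\<dots> \<le> f ((s + t) / 2)" using m(2) st by auto
      finally show "f u \<le> f ((s + t) / 2)" .
    qed
    thus ?thesis using that[of "(s + t) / 2"] st by auto
  qed (use that M m in auto)
qed

text \<open>Equal values at two points would force an interior extremum \<open>c\<close>. On a small
  interval around \<open>c\<close> any two points have ratio at least \<open>q\<close>, so
  \<open>f\<close> is injective, hence strictly monotone there, which an extremum excludes.\<close>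

lemma locally_injective_imp_injective:
  fixes f :: "real \<Rightarrow> real"
  assumes cont: "continuous_on {0<..<\<delta>} f" and q: "0 < q" "q < 1"
    and inj: "\<And>x t. 0 < x \<Longrightarrow> x < \<delta> \<Longrightarrow> q * x \<le> t \<Longrightarrow> t < x \<Longrightarrow> f t \<noteq> f x"
  shows "inj_on f {0<..<\<delta>}"
proof (rule linorder_inj_onI')
  fix x y assume xy: "x \<in> {0<..<\<delta>}" "y \<in> {0<..<\<delta>}" "x < y"
  show "f x \<noteq> f y"
  proof
    assume "f x = f y"
    moreover have "continuous_on {x..y} f" by (rule continuous_on_subset[OF cont]) (use xy in auto)
    ultimately obtain c where c: "x < c" "c < y"
       "(\<forall>u\<in>{x..y}. f u \<le> f c) \<or> (\<forall>u\<in>{x..y}. f c \<le> f u)"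
      using local_extremum_between[OF xy(3)] by blast
    have "c > 0" using xy c by auto
    \<comment> \<open>The first bound keeps the interval around \<open>c\<close> within
      \<open>[x, y]\<close>; the second gives \<open>q * (c + \<eta>) \<le> c - \<eta>\<close>, so
      that \<open>inj\<close> applies to every pair in it.\<close>
    define \<eta> where "\<eta> = min (min (c - x) (y - c)) (c * (1 - q) / 2)"
    have "\<eta> > 0" using c q \<open>c > 0\<close> by (simp add: \<eta>_def)
    have "\<eta> \<le> c * (1 - q) / 2" unfolding \<eta>_def by (rule min.cobounded2)
    moreover have "q * \<eta> \<le> \<eta>" using q \<open>\<eta> > 0\<close> by simp
    ultimately have qc: "q * (c + \<eta>) \<le> c - \<eta>" by (simp add: algebra_simps)
    have sub: "c - \<eta> \<ge> x" "c + \<eta> \<le> y" by (auto simp: \<eta>_def)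
    have "inj_on f {c - \<eta>..c + \<eta>}"
    proof (rule linorder_inj_onI')
      fix u v assume uv: "u \<in> {c - \<eta>..c + \<eta>}" "v \<in> {c - \<eta>..c + \<eta>}" "u < v"
      have "q * v \<le> q * (c + \<eta>)" using uv q by simp
      thus "f u \<noteq> f v" using inj[of v u] uv qc sub xy by auto
    qed
    moreover have "continuous_on {c - \<eta>..c + \<eta>} f"
      by (rule continuous_on_subset[OF cont]) (use xy sub in auto)
    ultimately have "strict_mono_on {c - \<eta>..c + \<eta>} f \<or> strict_antimono_on {c - \<eta>..c + \<eta>} f"
      using injective_eq_monotone_map[of "{c - \<eta>..c + \<eta>}" f] by (simp add: is_interval_cc)
    hence "(f (c - \<eta>) < f c \<and> f c < f (c + \<eta>)) \<or> (f (c - \<eta>) > f c \<and> f c > f (c + \<eta>))"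
      using \<open>\<eta> > 0\<close> by (auto simp: monotone_on_def)
    thus False using c sub \<open>\<eta> > 0\<close> by (smt (verit) atLeastAtMost_iff)
  qed
qed

text \<open>The mesh bound is applied to \<open>F = G / H - L\<close>. Its monotonicity and limit
  come from \<open>mono\<close> and \<open>lim\<close>; the delay hypothesis \<open>step\<close>
  comes from the monotonicity of the injective chord function.\<close>

lemma local_injectivity_bound_increasing:
  fixes G H :: "real \<Rightarrow> real"
  assumes q: "0 < q" "q < 1" and T: "0 < T" and \<delta>: "0 < \<delta>"
    and cont: "continuous_on {0<..<\<delta>} G" "continuous_on {0<..<\<delta>} H"
    and Hpos: "\<And>x. 0 < x \<Longrightarrow> x < \<delta> \<Longrightarrow> 0 < H x"
    and lim: "((\<lambda>x. G x / H x) \<longlongrightarrow> L) (at_right 0)"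
    and inj: "\<And>x. 0 < x \<Longrightarrow> x < \<delta> \<Longrightarrow> inj_on (\<lambda>t. G x * H t - H x * G t) {q * x..x}"
    and growth: "\<And>s t. 0 < s \<Longrightarrow> s < t \<Longrightarrow> t < \<delta> \<Longrightarrow> H s * ((ln t - ln s) / T) \<le> H t - H s"
    and mono: "strict_mono_on {0<..<\<delta>} (\<lambda>x. G x / H x)"
  shows "- ln q \<le> T"
proof (rule geometric_mesh_bound[OF q T \<delta>])
  define f where "f x = G x / H x" for x
  have mono': "f x < f y" if "0 < x" "x < y" "y < \<delta>" for x y
    using mono that by (auto simp: monotone_on_def f_def)
  have fL: "f x > L" if x: "0 < x" "x < \<delta>" for x
  proof -
    have "f (x / 2) \<ge> L"
    proof (rule tendsto_upperbound)
      \<comment> \<open>Comparing with \<open>f (x / 2)\<close> instead of \<open>f x\<close> leaves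
        room for the strict inequality, which a limit alone would not give.\<close>
      show "(f \<longlongrightarrow> L) (at_right 0)" using lim by (simp add: f_def[abs_def])
      show "\<forall>\<^sub>F u in at_right 0. f u \<le> f (x / 2)"
        unfolding eventually_at_right_field using mono'[of _ "x / 2"] x
        by (intro exI[of _ "x/2"]) (auto intro: less_imp_le)
    qed simp
    thus ?thesis using mono'[of "x/2" x] x by auto
  qed
  show "0 < G x / H x - L" if "0 < x" "x < \<delta>" for x
    using fL[OF that] by (simp add: f_def)
  show "G x / H x - L \<le> G y / H y - L" if "0 < x" "x \<le> y" "y < \<delta>" for x y
    using mono'[of x y] that by (cases "x = y") (auto simp: f_def)
  show "((\<lambda>x. G x / H x - L) \<longlongrightarrow> 0) (at_right 0)"
    using tendsto_diff[OF lim tendsto_const[of L]] by simp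
  show "H (q * x) * (G (q * x) / H (q * x) - L - (G x / H x - L)) \<le> H t * (G t / H t - L - (G x / H x - L))"
    if x: "0 < x" "x < \<delta>" and t: "q * x \<le> t" "t \<le> x" for x t
  proof -
    define \<psi> where "\<psi> t = G x * H t - H x * G t" for t
    have qx: "0 < q * x" "q * x < x" using q x by auto
    have \<psi>: "\<psi> u = - (H x) * (H u * (f u - f x))" if "0 < u" "u < \<delta>" for u
    proof -
      \<comment> \<open>In this factored form \<open>\<psi>\<close> vanishes at \<open>x\<close> and
        is positive at \<open>q * x\<close>; being injective and continuous, it must decrease.
        Dividing by \<open>- H x\<close> turns this into the claim.\<close>
      have "\<psi> u = H x * f x * H u - H x * (H u * f u)"
        using Hpos[OF that] Hpos[OF x] by (simp add: \<psi>_def f_def)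
      thus ?thesis by (simp add: algebra_simps)
    qed
    have "continuous_on {q * x..x} \<psi>"
      unfolding \<psi>_def using qx x
      by (intro continuous_intros continuous_on_subset[OF cont(1)] continuous_on_subset[OF cont(2)]) auto
    moreover have "inj_on \<psi> {q * x..x}" using inj[OF x] unfolding \<psi>_def .
    ultimately have "strict_mono_on {q * x..x} \<psi> \<or> strict_antimono_on {q * x..x} \<psi>"
      using injective_eq_monotone_map[of "{q * x..x}" \<psi>] by (simp add: is_interval_cc)
    moreover have "\<psi> (q * x) > \<psi> x"
    proof -
      have "H x * (H (q * x) * (f (q * x) - f x)) < 0"
        using qx x mono'[of "q * x" x] by (intro mult_pos_neg Hpos) linarith+
      thus ?thesis using \<psi>[of "q * x"] \<psi>[of x] qx x by simp
    qed
    ultimately have "strict_antimono_on {q * x..x} \<psi>"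
      using monotone_onD[of "{q * x..x}" "(<)" "(<)" \<psi> "q * x" x] qx q by auto
    hence "\<psi> t \<le> \<psi> (q * x)"
      using t by (cases "q * x = t") (auto simp: monotone_on_def less_imp_le)
    hence "H x * (H (q * x) * (f (q * x) - f x)) \<le> H x * (H t * (f t - f x))"
      using \<psi>[of "q * x"] \<psi>[of t] qx x t by auto
    thus ?thesis using Hpos[OF x] by (simp add: f_def)
  qed
qed (use Hpos growth in auto)

text \<open>If \<open>G / H\<close> took the same value at \<open>t\<close> and \<open>x\<close>,
  the chord function for \<open>x\<close> would agree at these points. So the ratio is locally
  injective, hence strictly monotone; replacing \<open>G\<close> and \<open>L\<close> by their
  negatives reduces the decreasing case to the increasing one.\<close>

lemma local_injectivity_bound:
  fixes G H :: "real \<Rightarrow> real"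
  assumes q: "0 < q" "q < 1" and T: "0 < T" and \<delta>: "0 < \<delta>"
    and cont: "continuous_on {0<..<\<delta>} G" "continuous_on {0<..<\<delta>} H"
    and Hpos: "\<And>x. 0 < x \<Longrightarrow> x < \<delta> \<Longrightarrow> 0 < H x"
    and lim: "((\<lambda>x. G x / H x) \<longlongrightarrow> L) (at_right 0)"
    and inj: "\<And>x. 0 < x \<Longrightarrow> x < \<delta> \<Longrightarrow> inj_on (\<lambda>t. G x * H t - H x * G t) {q * x..x}"
    and growth: "\<And>s t. 0 < s \<Longrightarrow> s < t \<Longrightarrow> t < \<delta> \<Longrightarrow> H s * ((ln t - ln s) / T) \<le> H t - H s"
  shows "- ln q \<le> T"
proof -
  let ?f = "\<lambda>x. G x / H x"
  have cf: "continuous_on {0<..<\<delta>} ?f"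
    using Hpos by (intro continuous_intros cont) force
  have "inj_on ?f {0<..<\<delta>}"
  proof (rule locally_injective_imp_injective[OF cf q])
    fix x t assume x: "0 < x" "x < \<delta>" and t: "q * x \<le> t" "t < x"
    have "0 < q * x" using q x by simp
    hence pos: "0 < H t" "0 < H x" using Hpos x t by auto
    have "G x * H t - H x * G t \<noteq> G x * H x - H x * G x"
      using inj_onD[OF inj[OF x], of t x] t q x by auto
    hence "G t * H x \<noteq> G x * H t" by (simp add: mult.commute)
    thus "?f t \<noteq> ?f x" using pos by (simp add: frac_eq_eq)
  qed
  hence "strict_mono_on {0<..<\<delta>} ?f \<or> strict_antimono_on {0<..<\<delta>} ?f"
    using injective_eq_monotone_map[OF _ cf] by (simp add: is_interval_oo)
  thus ?thesis
  proof
    assume mono: "strict_mono_on {0<..<\<delta>} ?f"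
    show ?thesis
      by (rule local_injectivity_bound_increasing[where G = G and H = H and \<delta> = \<delta> and L = L])
         (fact q T \<delta> cont Hpos lim inj growth mono)+
  next
    assume anti: "strict_antimono_on {0<..<\<delta>} ?f"
    show ?thesis
    proof (rule local_injectivity_bound_increasing[where G = "\<lambda>x. - G x" and H = H and \<delta> = \<delta> and L = "- L"])
      show "continuous_on {0<..<\<delta>} (\<lambda>x. - G x)" by (intro continuous_intros cont)
      show "((\<lambda>x. - G x / H x) \<longlongrightarrow> - L) (at_right 0)"
        using tendsto_minus[OF lim] by simp
      show "strict_mono_on {0<..<\<delta>} (\<lambda>x. - G x / H x)"
        using anti by (auto simp: monotone_on_def)
      show "inj_on (\<lambda>t. - G x * H t - H x * - G t) {q * x..x}" if "0 < x" "x < \<delta>" for x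
        using inj[OF that] by (auto simp: inj_on_def)
    qed (fact q T \<delta> cont Hpos growth)+
  qed
qed

section \<open>Monotonicity from almost everywhere bounds on the slope\<close>

text \<open>The last point of \<open>[s, t]\<close> where \<open>P\<close> is at least
  \<open>P s\<close> must be \<open>t\<close>, since otherwise \<open>ev\<close> yields a later
  one.\<close>

lemma nondecreasing_if_eventually_right:
  fixes P :: "real \<Rightarrow> real"
  assumes st: "s \<le> t" and cont: "continuous_on {s..t} P"
    and ev: "\<And>x. s \<le> x \<Longrightarrow> x < t \<Longrightarrow> eventually (\<lambda>y. P x \<le> P y) (at_right x)"
  shows "P s \<le> P t"
proof -
  define A where "A = {x \<in> {s..t}. P s \<le> P x}"
  have "closed A"
    unfolding A_def by (intro continuous_on_closed_Collect_le cont continuous_on_const closed_atLeastAtMost)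
  moreover have "A \<subseteq> {s..t}" by (auto simp: A_def)
  ultimately have "compact A"
    using compact_Int_closed[OF compact_Icc, of A s t] by (simp add: Int_absorb1)
  moreover have "s \<in> A" using st by (simp add: A_def)
  ultimately obtain c where c': "c \<in> A" "\<And>x. x \<in> A \<Longrightarrow> x \<le> c"
    using compact_attains_sup[of A] by blast
  hence c: "c \<in> {s..t}" "P s \<le> P c" by (auto simp: A_def)
  have "c = t"
  proof (rule ccontr)
    assume "c \<noteq> t"
    hence "c < t" using c by auto
    hence "eventually (\<lambda>y. P c \<le> P y \<and> y \<in> {c<..<t}) (at_right c)"
      using ev[of c] c by (intro eventually_conj eventually_at_right_real) auto
    then obtain y where "P c \<le> P y" "y \<in> {c<..<t}"
      using eventually_happens'[OF trivial_limit_at_right_real] by blast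
    hence "y \<in> A" "c < y" using c by (auto simp: A_def)
    thus False using c'(2)[of y] by auto
  qed
  thus ?thesis using c by simp
qed

text \<open>Compensating \<open>G\<close> by a multiple of the measure of a small open neighbourhood of the
  exceptional null set makes the right lower derivative nonnegative everywhere.\<close>
lemma nondecreasing_if_ae_right:
  fixes G :: "real \<Rightarrow> real"
  assumes st: "s \<le> t" and cont: "continuous_on {s..t} G"
    and lower: "\<And>x y. s \<le> x \<Longrightarrow> x < y \<Longrightarrow> y \<le> t \<Longrightarrow> - K * (y - x) \<le> G y - G x"
    and N: "negligible N"
    and ev: "\<And>x \<epsilon>. s < x \<Longrightarrow> x < t \<Longrightarrow> x \<notin> N \<Longrightarrow> 0 < \<epsilon> \<Longrightarrow>
               eventually (\<lambda>y. - \<epsilon> * (y - x) \<le> G y - G x) (at_right x)"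
  shows "G s \<le> G t"
proof -
  define C where "C = \<bar>K\<bar>"
  have "C \<ge> 0" by (simp add: C_def)
  have lower': "- C * (y - x) \<le> G y - G x" if "s \<le> x" "x < y" "y \<le> t" for x y
  proof -
    have "K * (y - x) \<le> C * (y - x)" using that by (intro mult_right_mono) (auto simp: C_def)
    thus ?thesis using lower[OF that] by simp
  qed
  have approx: "G s \<le> G t + C * \<epsilon> + \<epsilon> * (t - s)" if "\<epsilon> > 0" for \<epsilon>
  proof -
    \<comment> \<open>The left endpoint joins the exceptional set because \<open>ev\<close> covers
      only interior points.\<close>
    have "negligible (insert s N)" using N by simp
    then have null: "insert s N \<in> null_sets lebesgue" by (simp add: negligible_iff_null_sets)
    obtain U where U: "open U" "insert s N \<subseteq> U" "U - insert s N \<in> lmeasurable"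
        "emeasure lebesgue (U - insert s N) < ennreal \<epsilon>"
      by (rule sets_lebesgue_outer_open[OF null_setsD2[OF null] \<open>\<epsilon> > 0\<close>])
    have Usets: "U \<in> sets lebesgue" using U(1) by simp
    have "emeasure lebesgue U < ennreal \<epsilon>"
      using U(4) emeasure_Diff_null_set[OF null Usets] by simp
    define \<Psi> where "\<Psi> x = measure lebesgue (U \<inter> {s..x})" for x
    have lm: "U \<inter> {x..y} \<in> lmeasurable" for x y
      by (rule bounded_set_imp_lmeasurable) (use Usets in \<open>auto intro: bounded_Int\<close>)
    have \<Psi>diff: "\<Psi> y - \<Psi> x = measure lebesgue (U \<inter> {x..y})" if "s \<le> x" "x \<le> y" for x y
    proof -
      have "U \<inter> {s..y} = (U \<inter> {s..x}) \<union> (U \<inter> {x..y})" using that by auto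
      moreover have "negligible ((U \<inter> {s..x}) \<inter> (U \<inter> {x..y}))"
        by (rule negligible_subset[of "{x}"]) auto
      ultimately show ?thesis
        unfolding \<Psi>_def using measure_Un3_negligible[OF lm[of s x] lm[of x y], of "{}"] by simp
    qed
    have \<Psi>le: "\<Psi> y - \<Psi> x \<le> y - x" and \<Psi>mono: "\<Psi> x \<le> \<Psi> y" if "s \<le> x" "x \<le> y" for x y
    proof -
      have "measure lebesgue (U \<inter> {x..y}) \<le> measure lebesgue {x..y}"
        by (rule measure_mono_fmeasurable) (use lm[of x y] lmeasurable_cbox[of x y] in \<open>auto simp: fmeasurableD\<close>)
      thus "\<Psi> y - \<Psi> x \<le> y - x" using \<Psi>diff[OF that] that by simp
      show "\<Psi> x \<le> \<Psi> y" using \<Psi>diff[OF that] measure_nonneg[of lebesgue "U \<inter> {x..y}"] by linarith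
    qed
    have "\<bar>\<Psi> y - \<Psi> x\<bar> \<le> \<bar>y - x\<bar>" if "s \<le> x" "s \<le> y" for x y
      using \<Psi>le[of x y] \<Psi>mono[of x y] \<Psi>le[of y x] \<Psi>mono[of y x] that by linarith
    hence c\<Psi>: "continuous_on {s..t} \<Psi>"
      by (intro continuous_on_iff[THEN iffD2] ballI allI impI)
         (metis atLeastAtMost_iff dist_real_def order_le_less_trans)
    \<comment> \<open>Inside \<open>U\<close>, \<open>\<Psi>\<close> has slope 1 and
      \<open>C * \<Psi>\<close> offsets the worst decrease allowed by \<open>lower'\<close>; outside
      \<open>U\<close> the linear term offsets the decrease allowed by \<open>ev\<close>.\<close>
    define P where "P x = G x + C * \<Psi> x + \<epsilon> * (x - s)" for x
    have "P s \<le> P t"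
    proof (rule nondecreasing_if_eventually_right[OF st])
      show "continuous_on {s..t} P" unfolding P_def by (intro continuous_intros cont c\<Psi>)
      fix x assume x: "s \<le> x" "x < t"
      show "eventually (\<lambda>y. P x \<le> P y) (at_right x)"
      proof (cases "x \<in> U")
        case True
        then obtain d where d: "d > 0" "cball x d \<subseteq> U" using U(1) open_contains_cball by blast
        have "eventually (\<lambda>y. y \<in> {x<..<min t (x + d)}) (at_right x)"
          using x d by (intro eventually_at_right_real) auto
        thus ?thesis
        proof eventually_elim
          fix y assume y: "y \<in> {x<..<min t (x + d)}"
          have "U \<inter> {x..y} = {x..y}" using d y by (auto simp: subset_iff dist_real_def)
          hence "\<Psi> y - \<Psi> x = y - x" using \<Psi>diff[of x y] x y by simp
          hence "C * \<Psi> y - C * \<Psi> x = C * (y - x)" by (simp flip: right_diff_distrib)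
          moreover have "\<epsilon> * (x - s) \<le> \<epsilon> * (y - s)" using y \<open>\<epsilon> > 0\<close> by simp
          ultimately show "P x \<le> P y" using lower'[of x y] x y by (simp add: P_def)
        qed
      next
        case False
        hence "x \<noteq> s" "x \<notin> N" using U(2) by auto
        hence "eventually (\<lambda>y. - \<epsilon> * (y - x) \<le> G y - G x) (at_right x)" using x ev[of x \<epsilon>] \<open>\<epsilon> > 0\<close> by simp
        moreover have "eventually (\<lambda>y. y > x) (at_right x)" by (rule eventually_at_right_less)
        ultimately show ?thesis
        proof eventually_elim
          fix y assume y: "- \<epsilon> * (y - x) \<le> G y - G x" "x < y"
          have "C * \<Psi> x \<le> C * \<Psi> y" using \<Psi>mono[of x y] y x \<open>C \<ge> 0\<close> by (intro mult_left_mono) auto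
          thus "P x \<le> P y" using y by (simp add: P_def algebra_simps)
        qed
      qed
    qed
    moreover have "0 \<le> C * \<Psi> s" using \<open>C \<ge> 0\<close> by (simp add: \<Psi>_def)
    moreover have "\<Psi> t \<le> \<epsilon>"
    proof -
      have "emeasure lebesgue (U \<inter> {s..t}) \<le> emeasure lebesgue U"
        by (rule emeasure_mono) (use Usets in auto)
      also note \<open>emeasure lebesgue U < ennreal \<epsilon>\<close>
      finally have "ennreal (\<Psi> t) \<le> ennreal \<epsilon>"
        unfolding \<Psi>_def using emeasure_eq_measure2[of "U \<inter> {s..t}" lebesgue] lm[of s t] by simp
      thus ?thesis using \<open>\<epsilon> > 0\<close> by simp
    qed
    ultimately show ?thesis
      using mult_left_mono[of "\<Psi> t" \<epsilon> C] \<open>C \<ge> 0\<close> by (simp add: P_def)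
  qed
  show ?thesis
  proof (rule field_le_epsilon)
    fix e :: real assume "e > 0"
    define \<epsilon> where "\<epsilon> = e / (C + (t - s) + 1)"
    have D: "C + (t - s) + 1 > 0" using st \<open>C \<ge> 0\<close> by simp
    hence "\<epsilon> > 0" using \<open>e > 0\<close> by (simp add: \<epsilon>_def)
    have "C * \<epsilon> + \<epsilon> * (t - s) \<le> \<epsilon> * (C + (t - s) + 1)" using \<open>\<epsilon> > 0\<close> by (simp add: algebra_simps)
    also have "\<dots> = e" using D by (simp add: \<epsilon>_def)
    finally show "G s \<le> G t + e" using approx[OF \<open>\<epsilon> > 0\<close>] by simp
  qed
qed

section \<open>Differentiability of monotone functions\<close>

lemma negligible_nonexpansive_image:
  fixes k :: "real \<Rightarrow> real"
  assumes lip: "\<And>x y. \<bar>k x - k y\<bar> \<le> \<bar>x - y\<bar>" and A: "negligible A"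
  shows "negligible (k ` A)"
proof (rule negligible_locally_Lipschitz_image[OF _ A])
  show "\<exists>T B. open T \<and> x \<in> T \<and> (\<forall>y\<in>A \<inter> T. norm (k y - k x) \<le> B * norm (y - x))" for x
    using lip by (intro exI[of _ UNIV] exI[of _ 1]) auto
qed simp

text \<open>The push-forward of Lebesgue measure under the inverse of \<open>k\<close> assigns \<open>k y - k x\<close> to an
  interval and is absolutely continuous, hence has a density.\<close>
lemma nonexpansive_mono_bijection_ae_differentiable:
  fixes k w :: "real \<Rightarrow> real"
  assumes mono: "strict_mono k" and lip: "\<And>x y. \<bar>k x - k y\<bar> \<le> \<bar>x - y\<bar>"
    and kw: "\<And>x. k (w x) = x" and wk: "\<And>y. w (k y) = y"
  obtains N where "negligible N" "\<And>y. y \<notin> N \<Longrightarrow> k differentiable (at y)"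
proof -
  have le: "k x \<le> k y \<longleftrightarrow> x \<le> y" for x y
    using mono by (rule strict_mono_less_eq)
  have "mono w" by (rule monoI) (metis kw le)
  hence [measurable]: "w \<in> borel_measurable borel" by (rule borel_measurable_mono)
  define M where "M = distr lborel borel w"
  have Icc: "emeasure M {x..y} = ennreal (k y - k x)" if "x \<le> y" for x y
  proof -
    have "x \<le> w u \<longleftrightarrow> k x \<le> u" "w u \<le> y \<longleftrightarrow> u \<le> k y" for u
      using le[of x "w u"] le[of "w u" y] by (simp_all add: kw)
    hence "w -` {x..y} = {k x..k y}" by auto
    thus ?thesis using that by (simp add: M_def emeasure_distr le)
  qed
  \<comment> \<open>The preimage of \<open>A\<close> under \<open>w\<close> is the image under
    \<open>k\<close>, and nonexpansive maps preserve null sets.\<close>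
  have ac: "absolutely_continuous lborel M"
    unfolding absolutely_continuous_def
  proof
    fix A assume A: "A \<in> null_sets (lborel :: real measure)"
    hence neg: "negligible A" by (simp add: negligible_iff_null_sets null_sets_completionI)
    have "negligible (k ` A)"
      by (rule negligible_nonexpansive_image[OF lip neg])
    moreover have "k ` A = w -` A"
      by (auto simp: wk) (metis imageI kw)
    moreover have B: "w -` A \<in> sets borel"
      using measurable_sets_borel[of w borel A] A by auto
    ultimately have "emeasure lborel (w -` A) = 0"
      by (auto simp: negligible_iff_null_sets null_sets_def)
    thus "A \<in> null_sets M"
      using A by (auto simp: M_def null_sets_def emeasure_distr)
  qed
  obtain f where f [measurable]: "f \<in> borel_measurable lborel" and dens: "density lborel f = M"
    using sigma_finite_measure.Radon_Nikodym[OF sigma_finite_lborel ac] by (auto simp: M_def)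
  have int_f: "(\<integral>\<^sup>+u. f u * indicator {x..y} u \<partial>lborel) = ennreal (k y - k x)" if "x \<le> y" for x y
    using Icc[OF that] by (simp add: dens[symmetric] emeasure_density)
  have fin: "AE u in lborel. f u \<noteq> \<infinity>"
  proof -
    have "AE u in lborel. f u * indicator {- real n..real n} u \<noteq> \<infinity>" for n
      by (rule nn_integral_PInf_AE) (simp_all add: int_f)
    hence "AE u in lborel. \<forall>n. f u * indicator {- real n..real n} u \<noteq> \<infinity>"
      by (simp add: AE_all_countable)
    thus ?thesis
    proof eventually_elim
      fix u assume *: "\<forall>n. f u * indicator {- real n..real n} u \<noteq> \<infinity>"
      obtain n where "\<bar>u\<bar> \<le> real n" using real_arch_simple by blast
      thus "f u \<noteq> \<infinity>" using *[rule_format, of n] by (auto simp: indicator_def abs_le_iff)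
    qed
  qed
  define F where "F u = enn2real (f u)" for u
  have F [measurable]: "F \<in> borel_measurable borel" using f unfolding F_def by simp
  have int_F: "(F has_integral (k y - k x)) {x..y}" if "x \<le> y" for x y
  proof -
    have "(\<integral>\<^sup>+u. ennreal (F u * indicator {x..y} u) \<partial>lborel) = (\<integral>\<^sup>+u. f u * indicator {x..y} u \<partial>lborel)"
      by (rule nn_integral_cong_AE) (use fin in \<open>eventually_elim, auto simp: F_def indicator_def less_top\<close>)
    also have "\<dots> = ennreal (k y - k x)" by (rule int_f[OF that])
    finally have "((\<lambda>u. F u * indicator {x..y} u) has_integral (k y - k x)) UNIV"
      by (intro nn_integral_has_integral) (use that le in \<open>auto simp: F_def\<close>)
    thus ?thesis
      by (subst has_integral_restrict_UNIV [symmetric]) (simp add: indicator_def of_bool_def if_distrib cong: if_cong)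
  qed
  \<comment> \<open>The differentiation theorem used below averages over \<open>[x, x + h]\<close>
    only, so it controls right difference quotients. The reflected density supplies the left
    ones.\<close>
  have int_F': "((\<lambda>u. F (- u)) has_integral (k (- x) - k (- y))) {x..y}" if "x \<le> y" for x y
    using has_integral_reflect_real[where f = F and a = "- y" and b = "- x" and i = "k (- x) - k (- y)"] int_F[of "- y" "- x"] that by simp
  have intbl: "F integrable_on cbox x y" for x y
    using int_F[of x y] by (cases "x \<le> y") (auto intro: has_integral_integrable)
  have intbl': "(\<lambda>u. F (- u)) integrable_on cbox x y" for x y
    using int_F'[of x y] by (cases "x \<le> y") (auto intro: has_integral_integrable)
  obtain N1 where N1: "negligible N1"
    "\<And>x e. x \<notin> N1 \<Longrightarrow> 0 < e \<Longrightarrow> \<exists>d>0. \<forall>h. 0 < h \<and> h < d \<longrightarrow>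
          norm (integral (cbox x (x + h *\<^sub>R One)) F /\<^sub>R h ^ DIM(real) - F x) < e"
    using integrable_ccontinuous_explicit[of F] intbl
    by blast
  obtain N2 where N2: "negligible N2"
    "\<And>x e. x \<notin> N2 \<Longrightarrow> 0 < e \<Longrightarrow> \<exists>d>0. \<forall>h. 0 < h \<and> h < d \<longrightarrow>
          norm (integral (cbox x (x + h *\<^sub>R One)) (\<lambda>u. F (- u)) /\<^sub>R h ^ DIM(real) - F (- x)) < e"
    using integrable_ccontinuous_explicit[of "\<lambda>u. F (- u)"] intbl'
    by blast
  show thesis
  proof
    show "negligible (N1 \<union> uminus ` N2)"
      using N1(1) negligible_nonexpansive_image[OF _ N2(1), of uminus] by simp
    fix y assume "y \<notin> N1 \<union> uminus ` N2"
    hence y: "y \<notin> N1" "- y \<notin> N2" by (auto simp: image_iff)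
    have "(k has_field_derivative F y) (at y)"
      unfolding DERIV_def
    proof (rule tendstoI)
      fix e :: real assume "e > 0"
      obtain d1 where d1: "d1 > 0" "\<And>h. 0 < h \<Longrightarrow> h < d1 \<Longrightarrow> \<bar>(k (y + h) - k y) / h - F y\<bar> < e"
        using N1(2)[OF y(1) \<open>e > 0\<close>] int_F
        by (auto simp: integral_unique[OF int_F] divide_inverse mult.commute)
      obtain d2 where d2: "d2 > 0" "\<And>h. 0 < h \<Longrightarrow> h < d2 \<Longrightarrow> \<bar>(k y - k (y - h)) / h - F y\<bar> < e"
        using N2(2)[OF y(2) \<open>e > 0\<close>]
        by (auto simp: integral_unique[OF int_F'] divide_inverse mult.commute)
      have "dist ((k (y + h) - k y) / h) (F y) < e" if "h \<noteq> 0" "\<bar>h\<bar> < min d1 d2" for h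
      proof (cases "h > 0")
        case True
        thus ?thesis using d1(2)[of h] that by (simp add: dist_real_def)
      next
        case False
        hence "\<bar>(k y - k (y + h)) / (- h) - F y\<bar> < e" using d2(2)[of "- h"] that by simp
        thus ?thesis using minus_divide_divide[of "k (y + h) - k y" h] by (simp add: dist_real_def)
      qed
      thus "\<forall>\<^sub>F h in at 0. dist ((k (y + h) - k y) / h) (F y) < e"
        unfolding eventually_at using d1 d2 by (intro exI[of _ "min d1 d2"]) (auto simp: dist_real_def)
    qed
    thus "k differentiable (at y)" by (auto simp: real_differentiable_def)
  qed
qed

text \<open>The function \<open>x + h x\<close> has a nonexpansive inverse \<open>k\<close>, and \<open>h\<close> is differentiable
  at a point unless \<open>k\<close> has derivative zero at its image.\<close>
lemma mono_ae_differentiable_or_infinite_slope: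
  fixes h :: "real \<Rightarrow> real"
  assumes ab: "\<alpha> < \<beta>" and cont: "continuous_on {\<alpha>..\<beta>} h" and mono: "mono_on {\<alpha>..\<beta>} h"
  obtains N where "negligible N"
    "\<And>x. \<alpha> < x \<Longrightarrow> x < \<beta> \<Longrightarrow> x \<notin> N \<Longrightarrow> h differentiable (at x) \<or>
       filterlim (\<lambda>y. (h y - h x) / (y - x)) at_top (at_right x)"
proof -
  \<comment> \<open>Extending \<open>h\<close> by its endpoint values keeps it monotone and bounded,
    so that \<open>w\<close> is a bijection of the whole line.\<close>
  define e where "e x = h (min \<beta> (max \<alpha> x))" for x
  define w where "w x = x + e x" for x
  have e_mono: "e x \<le> e y" if "x \<le> y" for x y
    unfolding e_def using that ab by (intro mono_onD[OF mono]) auto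
  have e_eq: "e x = h x" if "\<alpha> \<le> x" "x \<le> \<beta>" for x using that by (simp add: e_def max_def min_def)
  have e_bounds: "h \<alpha> \<le> e x" "e x \<le> h \<beta>" for x
    unfolding e_def using ab by (auto intro!: mono_onD[OF mono])
  have "continuous_on UNIV e"
    unfolding e_def using ab
    by (intro continuous_on_compose2[OF cont] continuous_intros) auto
  hence contw: "continuous_on UNIV w" unfolding w_def by (intro continuous_intros)
  have w_less: "w x < w y" if "x < y" for x y
    using e_mono[of x y] that by (simp add: w_def)
  hence "inj w" by (intro linorder_injI) (metis less_irrefl)
  have "\<exists>x. w x = z" for z
  proof -
    have "\<exists>x\<ge>z - h \<beta>. x \<le> z - h \<alpha> \<and> w x = z"
      using e_bounds[of "z - h \<beta>"] e_bounds[of "z - h \<alpha>"] e_bounds[of \<alpha>]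
      by (intro IVT' continuous_on_subset[OF contw]) (auto simp: w_def)
    thus ?thesis by blast
  qed
  hence "surj w" by (metis surjI)
  define k where "k = inv w"
  have kw: "k (w x) = x" for x unfolding k_def using \<open>inj w\<close> by simp
  have wk: "w (k y) = y" for y unfolding k_def using \<open>surj w\<close> by (rule surj_f_inv_f)
  have "strict_mono k"
    by (rule strict_monoI) (metis w_less wk less_asym linorder_less_linear)
  have lip: "\<bar>k x - k y\<bar> \<le> \<bar>x - y\<bar>" for x y
  proof -
    have "\<bar>u - v\<bar> \<le> \<bar>w u - w v\<bar>" for u v
      using e_mono[of u v] e_mono[of v u] by (cases "u \<le> v") (auto simp: w_def)
    from this[of "k x" "k y"] show ?thesis by (simp add: wk)
  qed
  obtain N where N: "negligible N" "\<And>y. y \<notin> N \<Longrightarrow> k differentiable (at y)"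
    using nonexpansive_mono_bijection_ae_differentiable[OF \<open>strict_mono k\<close> lip kw wk] by blast
  show thesis
  proof
    show "negligible (k ` N)" by (rule negligible_nonexpansive_image[OF lip N(1)])
    fix x assume x: "\<alpha> < x" "x < \<beta>" "x \<notin> k ` N"
    have "w x \<notin> N" using x(3) kw[of x] by (metis imageI)
    then obtain d where d: "(k has_field_derivative d) (at (w x))"
      using N(2) by (auto simp: real_differentiable_def)
    have w_cont: "isCont w x" using contw by (simp add: continuous_on_eq_continuous_at)
    show "h differentiable (at x) \<or> filterlim (\<lambda>y. (h y - h x) / (y - x)) at_top (at_right x)"
    proof (cases "d = 0")
      case False
      have "(w has_field_derivative inverse d) (at x)"
        by (rule DERIV_inverse_function[where f = k and g = w and x = x and a = "x - 1" and b = "x + 1"])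
           (use d False in \<open>auto simp: kw w_cont\<close>)
      hence "((\<lambda>y. w y - y) has_field_derivative inverse d - 1) (at x)"
        by (intro DERIV_diff DERIV_ident)
      moreover have "w y - y = h y" if "y \<in> {\<alpha><..<\<beta>}" for y
        using that e_eq[of y] by (simp add: w_def)
      ultimately have "(h has_field_derivative inverse d - 1) (at x)"
        using x by (elim has_field_derivative_transform_within_open[where S = "{\<alpha><..<\<beta>}"]) auto
      thus ?thesis by (auto simp: real_differentiable_def)
    next
      \<comment> \<open>A zero derivative of the inverse gives \<open>w\<close> infinite slope at
        \<open>x\<close>; the slope of \<open>h\<close> is that of \<open>w\<close> minus 1.\<close>
      case True
      have "filterlim w (at (w x)) (at_right x)"
      proof (rule filterlim_atI)
        show "filterlim w (nhds (w x)) (at_right x)"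
          using w_cont unfolding isCont_def by (rule filterlim_mono[OF _ order_refl at_le]) simp
        show "\<forall>\<^sub>F y in at_right x. w y \<noteq> w x"
          using eventually_at_right_less by eventually_elim (metis w_less less_irrefl)
      qed
      moreover have "((\<lambda>z. (k z - k (w x)) / (z - w x)) \<longlongrightarrow> 0) (at (w x))"
        using d True by (simp add: has_field_derivative_iff)
      ultimately have "((\<lambda>y. (k (w y) - k (w x)) / (w y - w x)) \<longlongrightarrow> 0) (at_right x)"
        by (rule filterlim_compose[rotated])
      hence "((\<lambda>y. (y - x) / (w y - w x)) \<longlongrightarrow> 0) (at_right x)" by (simp add: kw)
      moreover have "\<forall>\<^sub>F y in at_right x. 0 < (y - x) / (w y - w x)"
        using eventually_at_right_less by eventually_elim (use w_less in auto)
      ultimately have "filterlim (\<lambda>y. inverse ((y - x) / (w y - w x))) at_top (at_right x)"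
        by (rule filterlim_inverse_at_top)
      hence "filterlim (\<lambda>y. - 1 + inverse ((y - x) / (w y - w x))) at_top (at_right x)"
        by (rule filterlim_tendsto_add_at_top[OF tendsto_const])
      moreover have "\<forall>\<^sub>F y in at_right x. - 1 + inverse ((y - x) / (w y - w x)) = (h y - h x) / (y - x)"
        using eventually_at_right_real[OF x(2)]
      proof eventually_elim
        case (elim y)
        hence "w y - w x = (y - x) + (h y - h x)"
          using e_eq[of y] e_eq[of x] x by (simp add: w_def)
        thus ?case using elim by (simp add: add_divide_distrib)
      qed
      ultimately have "filterlim (\<lambda>y. (h y - h x) / (y - x)) at_top (at_right x)"
        by (rule filterlim_cong[OF refl refl, THEN iffD1, rotated])
      thus ?thesis ..
    qed
  qed
qed

section \<open>Growth of the denominator\<close>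

text \<open>At points of differentiability the finite bound excludes a zero derivative, because
  \<open>ratio_fun\<close> is infinite there. Elsewhere \<open>deriv h x\<close> carries no
  information, and almost everywhere the infinite right slope takes its place.\<close>

lemma ratio_bound_ae:
  fixes h :: "real \<Rightarrow> real"
  assumes ad: "a < \<delta>" and cont: "continuous_on {a..\<delta>} h" and mono: "mono_on {a..\<delta>} h"
    and ae: "AE x in lebesgue. x \<in> {a..\<delta>} \<longrightarrow> ratio_fun a h x \<le> ereal T"
  obtains N where "negligible N"
    "\<And>x. a < x \<Longrightarrow> x < \<delta> \<Longrightarrow> x \<notin> N \<Longrightarrow>
       (\<exists>D>0. (h has_real_derivative D) (at x) \<and> (h x - h a) / ((x - a) * D) \<le> T) \<or>
       filterlim (\<lambda>y. (h y - h x) / (y - x)) at_top (at_right x)"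
proof -
  obtain N1 where N1: "negligible N1" "\<And>x. a < x \<Longrightarrow> x < \<delta> \<Longrightarrow> x \<notin> N1 \<Longrightarrow> h differentiable (at x) \<or>
       filterlim (\<lambda>y. (h y - h x) / (y - x)) at_top (at_right x)"
    using mono_ae_differentiable_or_infinite_slope[OF ad cont mono] by blast
  obtain N2 where N2: "N2 \<in> null_sets lebesgue"
      "{x. \<not> (x \<in> {a..\<delta>} \<longrightarrow> ratio_fun a h x \<le> ereal T)} \<subseteq> N2"
    using ae unfolding eventually_ae_filter by auto
  show thesis
  proof
    show "negligible (N1 \<union> N2)" using N1(1) N2(1) by (auto simp: negligible_iff_null_sets intro: null_sets.Un)
    fix x assume x: "a < x" "x < \<delta>" "x \<notin> N1 \<union> N2"
    have r: "ratio_fun a h x \<le> ereal T" 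
    proof -
      have "x \<notin> {x. \<not> (x \<in> {a..\<delta>} \<longrightarrow> ratio_fun a h x \<le> ereal T)}" using N2(2) x(3) by blast
      thus ?thesis using x(1,2) by simp
    qed
    show "(\<exists>D>0. (h has_real_derivative D) (at x) \<and> (h x - h a) / ((x - a) * D) \<le> T) \<or>
       filterlim (\<lambda>y. (h y - h x) / (y - x)) at_top (at_right x)"
    proof (cases "h differentiable (at x)")
      case True
      hence D: "(h has_real_derivative deriv h x) (at x)"
        by (simp add: DERIV_deriv_iff_real_differentiable)
      have "x \<in> interior {a..\<delta>}" using x by simp
      hence "deriv h x \<ge> 0" using mono_on_imp_deriv_nonneg[OF mono D] by blast
      moreover have "deriv h x \<noteq> 0" "(h x - h a) / ((x - a) * deriv h x) \<le> T"
        using r by (auto simp: ratio_fun_def split: if_splits)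
      ultimately show ?thesis using D by (intro disjI1 exI[of _ "deriv h x"]) simp
    qed (use N1(2) x in auto)
  qed
qed

text \<open>For \<open>T \<le> 0\<close> no finite positive derivative meets the ratio bound. The
  right slope would then be infinite almost everywhere, making \<open>h\<close> rise by more than
  any given amount.\<close>

lemma ratio_bound_pos:
  fixes h :: "real \<Rightarrow> real"
  assumes ad: "a < \<delta>" and cont: "continuous_on {a..\<delta>} h" and mono: "mono_on {a..\<delta>} h"
    and pos: "\<And>x. a < x \<Longrightarrow> x \<le> \<delta> \<Longrightarrow> h a < h x"
    and ae: "AE x in lebesgue. x \<in> {a..\<delta>} \<longrightarrow> ratio_fun a h x \<le> ereal T"
  shows "0 < T"
proof (rule ccontr)
  assume "\<not> 0 < T"
  obtain N where N: "negligible N" "\<And>x. a < x \<Longrightarrow> x < \<delta> \<Longrightarrow> x \<notin> N \<Longrightarrow>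
       (\<exists>D>0. (h has_real_derivative D) (at x) \<and> (h x - h a) / ((x - a) * D) \<le> T) \<or>
       filterlim (\<lambda>y. (h y - h x) / (y - x)) at_top (at_right x)"
    using ratio_bound_ae[OF ad cont mono ae] by blast
  have slope: "filterlim (\<lambda>y. (h y - h x) / (y - x)) at_top (at_right x)"
    if x: "a < x" "x < \<delta>" "x \<notin> N" for x
  proof -
    have "\<not> (h x - h a) / ((x - a) * D) \<le> T" if "D > 0" for D
    proof -
      have "0 < (h x - h a) / ((x - a) * D)" using pos[of x] x that by simp
      thus ?thesis using \<open>\<not> 0 < T\<close> by linarith
    qed
    thus ?thesis using N(2)[OF x] by blast
  qed
  \<comment> \<open>At slope \<open>M\<close> the rise over \<open>[a, \<delta>]\<close> would
    exceed the actual one by 1.\<close>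
  define M where "M = (h \<delta> - h a + 1) / (\<delta> - a)"
  have "h a - M * a \<le> h \<delta> - M * \<delta>"
  proof (rule nondecreasing_if_ae_right[OF less_imp_le[OF ad] _ _ N(1), where K = M])
    show "continuous_on {a..\<delta>} (\<lambda>x. h x - M * x)" by (intro continuous_intros cont)
    show "- M * (y - x) \<le> h y - M * y - (h x - M * x)" if "a \<le> x" "x < y" "y \<le> \<delta>" for x y
      using mono_onD[OF mono, of x y] that by (simp add: algebra_simps)
    fix x \<epsilon> :: real assume x: "a < x" "x < \<delta>" "x \<notin> N" and "0 < \<epsilon>"
    have "\<forall>\<^sub>F y in at_right x. M \<le> (h y - h x) / (y - x)"
      using slope[OF x] by (simp add: filterlim_at_top)
    thus "\<forall>\<^sub>F y in at_right x. - \<epsilon> * (y - x) \<le> h y - M * y - (h x - M * x)"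
      using eventually_at_right_less
    proof eventually_elim
      case (elim y)
      hence "M * (y - x) \<le> h y - h x" by (simp add: pos_le_divide_eq)
      moreover have "0 \<le> \<epsilon> * (y - x)" using elim \<open>0 < \<epsilon>\<close> by simp
      ultimately show ?case by (simp add: algebra_simps)
    qed
  qed
  hence "M * (\<delta> - a) \<le> h \<delta> - h a" by (simp add: algebra_simps)
  thus False using ad by (simp add: M_def)
qed

text \<open>The ratio bound says that \<open>ln (h x - h a) - ln (x - a) / T\<close> has nonnegative
  derivative at points of differentiability. Infinite slopes of \<open>h\<close> only help, so this
  difference is nondecreasing.\<close>

lemma ratio_bound_ln_growth:
  fixes h :: "real \<Rightarrow> real"
  assumes ad: "a < \<delta>" and cont: "continuous_on {a..\<delta>} h" and mono: "mono_on {a..\<delta>} h"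
    and pos: "\<And>x. a < x \<Longrightarrow> x \<le> \<delta> \<Longrightarrow> h a < h x"
    and ae: "AE x in lebesgue. x \<in> {a..\<delta>} \<longrightarrow> ratio_fun a h x \<le> ereal T"
    and st: "a < s" "s < t" "t \<le> \<delta>"
  shows "(ln (t - a) - ln (s - a)) / T \<le> ln (h t - h a) - ln (h s - h a)"
proof -
  have T: "0 < T" by (rule ratio_bound_pos[OF ad cont mono pos ae])
  obtain N where N: "negligible N" "\<And>x. a < x \<Longrightarrow> x < \<delta> \<Longrightarrow> x \<notin> N \<Longrightarrow>
       (\<exists>D>0. (h has_real_derivative D) (at x) \<and> (h x - h a) / ((x - a) * D) \<le> T) \<or>
       filterlim (\<lambda>y. (h y - h x) / (y - x)) at_top (at_right x)"
    using ratio_bound_ae[OF ad cont mono ae] by blast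
  define G where "G x = ln (h x - h a) - ln (x - a) / T" for x
  \<comment> \<open>\<open>K\<close> bounds the slope of \<open>ln (x - a) / T\<close> on
    \<open>[s, t]\<close>, which is finite because \<open>s\<close> stays away from
    \<open>a\<close>.\<close>
  define K where "K = 1 / (T * (s - a))"
  have lnx: "(ln (y - a) - ln (x - a)) / T \<le> K * (y - x)" if "s \<le> x" "x < y" for x y
  proof -
    have "ln (y - a) - ln (x - a) \<le> (y - x) / (x - a)"
      using ln_diff_le[of "y - a" "x - a"] that st by simp
    also have "\<dots> \<le> (y - x) / (s - a)" using that st by (intro divide_left_mono) auto
    finally have "(ln (y - a) - ln (x - a)) / T \<le> (y - x) / (s - a) / T"
      using T by (intro divide_right_mono) auto
    thus ?thesis by (simp add: K_def mult.commute)
  qed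
  have "G s \<le> G t"
  proof (rule nondecreasing_if_ae_right[OF less_imp_le[OF st(2)] _ _ N(1), where K = K])
    have "continuous_on {s..t} h" by (rule continuous_on_subset[OF cont]) (use st in auto)
    moreover have "h x \<noteq> h a" if "s \<le> x" "x \<le> t" for x using pos[of x] that st by auto
    ultimately show "continuous_on {s..t} G"
      unfolding G_def using st T by (intro continuous_intros) auto
    show "- K * (y - x) \<le> G y - G x" if xy: "s \<le> x" "x < y" "y \<le> t" for x y
    proof -
      have "h x \<le> h y" using xy st by (intro mono_onD[OF mono]) auto
      hence "ln (h x - h a) \<le> ln (h y - h a)" using pos[of x] pos[of y] xy st by simp
      thus ?thesis using lnx[OF xy(1,2)] by (simp add: G_def diff_divide_distrib)
    qed
    fix x \<epsilon> :: real assume x: "s < x" "x < t" "x \<notin> N" and \<epsilon>: "0 < \<epsilon>"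
    have hx: "0 < h x - h a" "0 < x - a" using pos[of x] x st by auto
    from N(2)[of x] x st consider
       D where "D > 0" "(h has_real_derivative D) (at x)" "(h x - h a) / ((x - a) * D) \<le> T"
     | "filterlim (\<lambda>y. (h y - h x) / (y - x)) at_top (at_right x)" by auto
    thus "\<forall>\<^sub>F y in at_right x. - \<epsilon> * (y - x) \<le> G y - G x"
    proof cases
      case 1
      have "(G has_real_derivative D / (h x - h a) - 1 / (x - a) / T) (at x)"
        unfolding G_def by (rule derivative_eq_intros 1(2) refl | use hx T in \<open>simp; fail\<close>)+
      hence "((\<lambda>y. (G y - G x) / (y - x)) \<longlongrightarrow> D / (h x - h a) - 1 / (x - a) / T) (at_right x)"
        unfolding has_field_derivative_iff by (rule filterlim_mono[OF _ order_refl at_le]) simp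
      moreover have "0 \<le> D / (h x - h a) - 1 / (x - a) / T"
      proof -
        have "h x - h a \<le> T * ((x - a) * D)" using 1 hx by (simp add: pos_divide_le_eq)
        hence "1 * (h x - h a) \<le> D * ((x - a) * T)" by (simp add: mult_ac)
        moreover have "0 < (x - a) * T" using hx T by simp
        ultimately have "1 / ((x - a) * T) \<le> D / (h x - h a)"
          by (simp only: pos_divide_le_eq times_divide_eq_left pos_le_divide_eq[OF hx(1)])
        thus ?thesis by simp
      qed
      ultimately have "\<forall>\<^sub>F y in at_right x. - \<epsilon> < (G y - G x) / (y - x)"
        using \<epsilon> by (intro order_tendstoD) auto
      thus ?thesis using eventually_at_right_less
      proof eventually_elim
        case (elim y)
        thus ?case using pos_less_divide_eq[of "y - x" "- \<epsilon>" "G y - G x"] by simp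
      qed
    next
      case 2
      \<comment> \<open>On \<open>[s, t]\<close> the logarithm turns a slope of \<open>h\<close>
        into at least that slope divided by \<open>h t - h a\<close>, so this threshold beats the
        logarithmic term in \<open>G\<close>.\<close>
      hence "\<forall>\<^sub>F y in at_right x. K * (h t - h a) \<le> (h y - h x) / (y - x)"
        by (simp add: filterlim_at_top)
      thus ?thesis using eventually_at_right_real[OF x(2)]
      proof eventually_elim
        case (elim y)
        have y: "0 < h y - h a" using pos[of y] elim x st by auto
        have "h y \<le> h t" using elim x st by (intro mono_onD[OF mono]) auto
        have "K * (y - x) * (h y - h a) \<le> K * (y - x) * (h t - h a)"
          using \<open>h y \<le> h t\<close> elim T st by (intro mult_left_mono) (auto simp: K_def)
        also have "\<dots> \<le> h y - h x"
          using elim pos_le_divide_eq[of "y - x" "K * (h t - h a)" "h y - h x"] by (simp add: mult_ac)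
        finally have "K * (y - x) \<le> (h y - h x) / (h y - h a)" using y by (simp add: pos_le_divide_eq)
        also have "\<dots> \<le> ln (h y - h a) - ln (h x - h a)"
        proof -
          have "ln (h x - h a) - ln (h y - h a) \<le> ((h x - h a) - (h y - h a)) / (h y - h a)"
            using y hx by (intro ln_diff_le) auto
          thus ?thesis using minus_divide_left[of "h y - h x" "h y - h a"] by simp
        qed
        finally have "0 \<le> G y - G x" using lnx[of x y] elim x by (simp add: G_def diff_divide_distrib)
        moreover have "0 \<le> \<epsilon> * (y - x)" using elim \<epsilon> by simp
        ultimately show ?case by simp
      qed
    qed
  qed
  thus ?thesis by (simp add: G_def diff_divide_distrib)
qed

section \<open>Local extrema\<close>

lemma mono_on_pos_if_nonconst:
  fixes h :: "real \<Rightarrow> real"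
  assumes mono: "mono_on {a..<b} h"
    and nonconst: "\<forall>\<delta>>0. \<exists>x\<in>{a..<b}. \<exists>y\<in>{a..<b}. x < a + \<delta> \<and> y < a + \<delta> \<and> h x \<noteq> h y"
    and x: "a < x" "x < b"
  shows "h a < h x"
proof -
  obtain u v where uv: "u \<in> {a..<b}" "v \<in> {a..<b}" "u < x" "v < x" "h u \<noteq> h v"
    using nonconst[rule_format, of "x - a"] x by auto
  have "h a \<le> h u" "h a \<le> h v" "h u \<le> h x" "h v \<le> h x"
    using uv x by (auto intro!: mono_onD[OF mono])
  thus ?thesis using uv(5) by linarith
qed

text \<open>Translating \<open>a\<close> and the values of \<open>h\<close> and \<open>g\<close>
  there to zero reduces this to \<open>local_injectivity_bound\<close>, on an interval where both
  the chord injectivity and the ratio bound hold.\<close>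

lemma injective_chords_bound:
  fixes a b \<delta> q T L :: real and h g :: "real \<Rightarrow> real"
  assumes ad: "a < \<delta>" "\<delta> < b" and q: "0 < q" "q < 1"
    and cont_h: "continuous_on {a..<b} h" and cont_g: "continuous_on {a..<b} g"
    and mono: "mono_on {a..<b} h"
    and pos: "\<And>x. a < x \<Longrightarrow> x < b \<Longrightarrow> h a < h x"
    and lim: "((\<lambda>x. (g x - g a) / (h x - h a)) \<longlongrightarrow> L) (at_right a)"
    and ae: "AE x in lebesgue. x \<in> {a..\<delta>} \<longrightarrow> ratio_fun a h x \<le> ereal T"
    and inj: "\<forall>\<^sub>F x in at_right a. inj_on (\<lambda>t. (g x - g a) * h t - (h x - h a) * g t) {a + q * (x - a)..x}"
  shows "- ln q \<le> T"
proof -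
  have cont': "continuous_on {a..\<delta>} h" by (rule continuous_on_subset[OF cont_h]) (use ad in auto)
  have mono': "mono_on {a..\<delta>} h" by (rule mono_on_subset[OF mono]) (use ad in auto)
  have pos': "h a < h x" if "a < x" "x \<le> \<delta>" for x using pos that ad by simp
  note growth = ratio_bound_ln_growth[OF ad(1) cont' mono' pos' ae]
  obtain c where c: "a < c" "\<And>x. a < x \<Longrightarrow> x < c \<Longrightarrow>
      inj_on (\<lambda>t. (g x - g a) * h t - (h x - h a) * g t) {a + q * (x - a)..x}"
    using inj unfolding eventually_at_right_field by blast
  define \<eta> where "\<eta> = min c \<delta> - a"
  have \<eta>: "\<eta> > 0" "a + \<eta> \<le> c" "a + \<eta> \<le> \<delta>" using c ad by (auto simp: \<eta>_def)
  define G where "G u = g (u + a) - g a" for u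
  define H where "H u = h (u + a) - h a" for u
  have Hpos: "0 < H u" if "0 < u" "u < \<eta>" for u
    using pos[of "u + a"] that \<eta> ad by (simp add: H_def)
  show ?thesis
  proof (rule local_injectivity_bound[where G = G and H = H and \<delta> = \<eta> and L = L])
    show "0 < T" by (rule ratio_bound_pos[OF ad(1) cont' mono' pos' ae])
    show "continuous_on {0<..<\<eta>} G" "continuous_on {0<..<\<eta>} H"
      unfolding G_def H_def using \<eta> ad
      by (auto intro!: continuous_intros continuous_on_compose2[OF cont_g] continuous_on_compose2[OF cont_h])
    show "((\<lambda>x. G x / H x) \<longlongrightarrow> L) (at_right 0)"
      using lim unfolding G_def H_def by (subst (asm) filterlim_at_right_to_0)
    show "inj_on (\<lambda>t. G x * H t - H x * G t) {q * x..x}" if "0 < x" "x < \<eta>" for x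
    proof (rule inj_onI)
      fix s t assume st: "s \<in> {q * x..x}" "t \<in> {q * x..x}" "G x * H s - H x * G s = G x * H t - H x * G t"
      have "s + a = t + a"
        by (rule inj_onD[OF c(2)[of "x + a"]])
           (use st that \<eta> in \<open>auto simp: G_def H_def right_diff_distrib\<close>)
      thus "s = t" by simp
    qed
    show "H s * ((ln t - ln s) / T) \<le> H t - H s" if "0 < s" "s < t" "t < \<eta>" for s t
    proof -
      have H: "0 < H s" "0 < H t" using Hpos that by auto
      have "(ln t - ln s) / T \<le> ln (H t) - ln (H s)"
        using growth[of "s + a" "t + a"] that \<eta> by (simp add: H_def)
      \<comment> \<open>Concavity of the logarithm turns logarithmic growth into the linear form
        that the mesh argument uses.\<close>
      also have "\<dots> \<le> (H t - H s) / H s" using H by (intro ln_diff_le) auto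
      finally show ?thesis using H by (simp add: pos_le_divide_eq mult.commute)
    qed
  qed (use q \<eta> Hpos in auto)
qed

text \<open>The hypothesis on \<open>\<nu>\<close> is what \<open>mu_fun\<close> and \<open>xi_fun\<close> have in common.  It makes \<open>\<phi>\<^sub>x\<close>
  injective on \<open>[a + q (x - a), x]\<close> whenever \<open>\<nu> x < a + q (x - a)\<close>.\<close>
lemma Limsup_ge_exp_neg_ess_limsup:
  fixes a b :: real and h g \<nu> :: "real \<Rightarrow> real"
  assumes ab: "a < b"
    and cont_h: "continuous_on {a..<b} h" and cont_g: "continuous_on {a..<b} g"
    and mono: "mono_on {a..<b} h"
    and pos: "\<And>x. a < x \<Longrightarrow> x < b \<Longrightarrow> h a < h x"
    and lim: "((\<lambda>x. (g x - g a) / (h x - h a)) \<longlongrightarrow> L) (at_right a)"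
    and \<nu>: "\<And>x s t. \<lbrakk>a \<le> s; s < t; t \<le> x; x < b;
      (g x - g a) * h s - (h x - h a) * g s = (g x - g a) * h t - (h x - h a) * g t\<rbrakk> \<Longrightarrow> s < \<nu> x"
  shows "exp_neg_ereal (ess_limsup_right a b (ratio_fun a h))
     \<le> Limsup (at_right a) (\<lambda>x. ereal ((\<nu> x - a) / (x - a)))" (is "_ \<le> ?L")
proof -
  define S where "S = {t. \<exists>\<delta>. a < \<delta> \<and> \<delta> < b \<and>
      (AE x in lebesgue. x \<in> {a..\<delta>} \<longrightarrow> ratio_fun a h x \<le> ereal t)}"
  define C where "C = Inf (ereal ` S)"
  have CS: "ess_limsup_right a b (ratio_fun a h) = C" by (simp add: C_def S_def ess_limsup_right_def)
  have near: "\<forall>\<^sub>F x in at_right a. x \<in> {a<..<b}" using ab by (rule eventually_at_right_real)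
  have L0: "0 \<le> ?L"
  proof (rule le_Limsup)
    show "\<forall>\<^sub>F x in at_right a. 0 \<le> ereal ((\<nu> x - a) / (x - a))"
      using near
    proof eventually_elim
      case (elim x)
      \<comment> \<open>\<open>\<phi>\<^sub>x\<close> takes equal values at \<open>a\<close> and
        \<open>x\<close>. The resulting nonnegativity settles the case
        \<open>C = \<infinity>\<close>.\<close>
      hence "a < \<nu> x" by (intro \<nu>[of a x x]) (auto simp: algebra_simps)
      thus ?case using elim by simp
    qed
  qed simp
  have Spos: "0 < T" if "T \<in> S" for T
  proof -
    obtain \<delta> where \<delta>: "a < \<delta>" "\<delta> < b" "AE x in lebesgue. x \<in> {a..\<delta>} \<longrightarrow> ratio_fun a h x \<le> ereal T"
      using \<open>T \<in> S\<close> by (auto simp: S_def)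
    show ?thesis
    proof (rule ratio_bound_pos[OF \<delta>(1) _ _ _ \<delta>(3)])
      show "continuous_on {a..\<delta>} h" by (rule continuous_on_subset[OF cont_h]) (use \<delta> in auto)
      show "mono_on {a..\<delta>} h" by (rule mono_on_subset[OF mono]) (use \<delta> in auto)
    qed (use pos \<delta> in auto)
  qed
  have "0 \<le> C" unfolding C_def using Spos by (intro Inf_greatest) (auto intro: less_imp_le)
  then consider c where "C = ereal c" "0 \<le> c" | "C = \<infinity>" by (cases C) auto
  thus ?thesis
  proof cases
    case 2
    thus ?thesis using L0 by (simp add: CS exp_neg_ereal_def)
  next
    case (1 c)
    have "ereal (exp (- c)) \<le> ?L"
    proof (rule ccontr)
      assume "\<not> ereal (exp (- c)) \<le> ?L"
      hence "?L < ereal (exp (- c))" by (simp only: not_le)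
      \<comment> \<open>\<open>q\<close> lies strictly between the upper limit and
        \<open>exp (- c)\<close>: the first makes chords eventually injective, forcing
        \<open>- ln q \<le> C\<close>, and the second makes \<open>- ln q > c\<close>.\<close>
      then obtain q where q: "?L < ereal q" "q < exp (- c)"
        using ereal_dense2[of ?L "ereal (exp (- c))"] by auto
      have "0 < ereal q" using L0 q(1) by (rule order_le_less_trans)
      hence "0 < q" by simp
      moreover have "exp (- c) \<le> 1" using 1(2) by simp
      ultimately have q01: "0 < q" "q < 1" using q(2) by linarith+
      have "\<forall>\<^sub>F x in at_right a. ereal ((\<nu> x - a) / (x - a)) < ereal q"
        using q(1) by (rule Limsup_lessD)
      hence inj: "\<forall>\<^sub>F x in at_right a.
          inj_on (\<lambda>t. (g x - g a) * h t - (h x - h a) * g t) {a + q * (x - a)..x}"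
        using near
      proof eventually_elim
        case (elim x)
        hence \<nu>x: "\<nu> x < a + q * (x - a)" by (simp add: pos_divide_less_eq)
        have "0 \<le> q * (x - a)" using elim q01 by simp
        hence "s < \<nu> x"
          if "s \<in> {a + q * (x - a)..x}" "t \<in> {a + q * (x - a)..x}" "s < t"
             "(g x - g a) * h s - (h x - h a) * g s = (g x - g a) * h t - (h x - h a) * g t" for s t
          using that elim by (intro \<nu>[of s t x]) auto
        thus ?case using \<nu>x by (intro linorder_inj_onI') fastforce
      qed
      have "ereal (- ln q) \<le> C"
        unfolding C_def
      proof (rule Inf_greatest)
        fix y assume "y \<in> ereal ` S"
        then obtain T \<delta> where "y = ereal T" "a < \<delta>" "\<delta> < b"
          "AE x in lebesgue. x \<in> {a..\<delta>} \<longrightarrow> ratio_fun a h x \<le> ereal T"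
          by (auto simp: S_def)
        thus "ereal (- ln q) \<le> y"
          using injective_chords_bound[OF _ _ q01 cont_h cont_g mono pos lim _ inj] by simp
      qed
      moreover have "ln q < - c" using q01(1) q(2) by (simp add: ln_less_cancel_iff[of q "exp (- c)", symmetric] del: ln_less_cancel_iff)
      ultimately show False using 1 by simp
    qed
    thus ?thesis using 1 by (simp add: CS exp_neg_ereal_def)
  qed
qed

text \<open>Equal values enclose an extremum strictly between \<open>s\<close> and \<open>t\<close>,
  which competes in the supremum; the bound \<open>x\<close> makes that supremum a genuine upper
  bound.\<close>

lemma mu_fun_gt:
  fixes a b s t x :: real and h g :: "real \<Rightarrow> real"
  assumes cont_h: "continuous_on {a..<b} h" and cont_g: "continuous_on {a..<b} g"
    and st: "a \<le> s" "s < t" "t \<le> x" "x < b"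
    and eq: "(g x - g a) * h s - (h x - h a) * g s = (g x - g a) * h t - (h x - h a) * g t"
  shows "s < mu_fun a b h g x"
proof -
  define \<phi> where "\<phi> t = (g x - g a) * h t - (h x - h a) * g t" for t
  have "continuous_on {s..t} \<phi>"
    unfolding \<phi>_def using st
    by (intro continuous_intros continuous_on_subset[OF cont_h] continuous_on_subset[OF cont_g]) auto
  then obtain c where c: "s < c" "c < t" "(\<forall>u\<in>{s..t}. \<phi> u \<le> \<phi> c) \<or> (\<forall>u\<in>{s..t}. \<phi> c \<le> \<phi> u)"
    using local_extremum_between[OF st(2)] eq unfolding \<phi>_def by blast
  \<comment> \<open>Within distance \<open>r\<close> of \<open>c\<close> all points lie in
    \<open>[s, t]\<close>, so the extremum over \<open>[s, t]\<close> is a local one in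
    \<open>[a, b)\<close>.\<close>
  define r where "r = min (c - s) (t - c)"
  have "0 < r" using c by (simp add: r_def)
  moreover have "u \<in> {s..t}" if "\<bar>u - c\<bar> < r" for u using that by (auto simp: r_def)
  moreover have "c \<in> {a..<b}" using c st by simp
  ultimately have "local_extremum_on {a..<b} \<phi> c"
    unfolding local_extremum_on_def using c(3) by meson
  hence "c \<le> mu_fun a b h g x"
    unfolding mu_fun_def \<phi>_def using c st by (intro cSup_upper bdd_aboveI[of _ x]) auto
  thus ?thesis using c by simp
qed

text \<open>Rolle's theorem replaces the enclosed extremum: a zero of the derivative of
  \<open>\<phi>\<^sub>x\<close> is a solution of the mean value equation, because
  \<open>h x - h a\<close> and \<open>deriv h\<close> are positive.\<close>

lemma xi_fun_gt:
  fixes a b s t x :: real and h g :: "real \<Rightarrow> real"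
  assumes cont_h: "continuous_on {a..<b} h" and cont_g: "continuous_on {a..<b} g"
    and diff: "\<forall>t\<in>{a<..<b}. h differentiable (at t) \<and> g differentiable (at t) \<and> deriv h t > 0"
    and pos: "h a < h x"
    and st: "a \<le> s" "s < t" "t \<le> x" "x < b"
    and eq: "(g x - g a) * h s - (h x - h a) * g s = (g x - g a) * h t - (h x - h a) * g t"
  shows "s < xi_fun a h g x"
proof -
  define \<phi> where "\<phi> t = (g x - g a) * h t - (h x - h a) * g t" for t
  have der: "(\<phi> has_real_derivative (g x - g a) * deriv h u - (h x - h a) * deriv g u) (at u)"
    if "s < u" "u < t" for u
    using diff that st unfolding \<phi>_def
    by (intro DERIV_diff DERIV_cmult) (auto simp: DERIV_deriv_iff_real_differentiable)
  have "continuous_on {s..t} \<phi>"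
    unfolding \<phi>_def using st
    by (intro continuous_intros continuous_on_subset[OF cont_h] continuous_on_subset[OF cont_g]) auto
  then obtain c where c: "s < c" "c < t" "(\<phi> has_real_derivative 0) (at c)"
    using Rolle[of s t \<phi>] eq der st unfolding \<phi>_def[symmetric] by (metis real_differentiable_def)
  have "(g x - g a) * deriv h c - (h x - h a) * deriv g c = 0"
    using DERIV_unique[OF der c(3)] c by simp
  moreover have "deriv h c > 0" using diff c st by simp
  ultimately have "(g x - g a) / (h x - h a) = deriv g c / deriv h c"
    using pos by (simp add: frac_eq_eq mult.commute)
  hence "c \<le> xi_fun a h g x"
    unfolding xi_fun_def using c st by (intro cSup_upper bdd_aboveI[of _ x]) auto
  thus ?thesis using c by simp
qed

theorem theorem5:
  fixes a b :: real and h g :: "real \<Rightarrow> real"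
  assumes ab: "a < b"
    and cont_h: "continuous_on {a..<b} h" and cont_g: "continuous_on {a..<b} g"
    and mono_h: "mono_on {a..<b} h"
    and nonconst: "\<forall>\<delta>>0. \<exists>x\<in>{a..<b}. \<exists>y\<in>{a..<b}. x < a + \<delta> \<and> y < a + \<delta> \<and> h x \<noteq> h y"
    and lim: "\<exists>L. ((\<lambda>x. (g x - g a) / (h x - h a)) \<longlongrightarrow> L) (at_right a)"
  shows "Limsup (at_right a) (\<lambda>x. ereal ((mu_fun a b h g x - a) / (x - a)))
           \<ge> exp_neg_ereal (ess_limsup_right a b (ratio_fun a h))
     \<and> ((\<forall>t\<in>{a<..<b}. h differentiable (at t) \<and> g differentiable (at t) \<and> deriv h t > 0) \<longrightarrow>
         Limsup (at_right a) (\<lambda>x. ereal ((xi_fun a h g x - a) / (x - a)))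
           \<ge> exp_neg_ereal (ess_limsup_right a b (ratio_fun a h)))"
proof -
  obtain L where L: "((\<lambda>x. (g x - g a) / (h x - h a)) \<longlongrightarrow> L) (at_right a)"
    using lim by blast
  have pos: "h a < h x" if "a < x" "x < b" for x
    using mono_on_pos_if_nonconst[OF mono_h nonconst that] .
  note main = Limsup_ge_exp_neg_ess_limsup[OF ab cont_h cont_g mono_h _ L]
  show ?thesis
  proof (intro conjI impI)
    show "Limsup (at_right a) (\<lambda>x. ereal ((mu_fun a b h g x - a) / (x - a)))
        \<ge> exp_neg_ereal (ess_limsup_right a b (ratio_fun a h))"
      by (rule main) (blast intro: pos, rule mu_fun_gt[OF cont_h cont_g])
  next
    assume diff: "\<forall>t\<in>{a<..<b}. h differentiable (at t) \<and> g differentiable (at t) \<and> deriv h t > 0"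
    show "Limsup (at_right a) (\<lambda>x. ereal ((xi_fun a h g x - a) / (x - a)))
        \<ge> exp_neg_ereal (ess_limsup_right a b (ratio_fun a h))"
    proof (rule main)
      fix x s t assume st: "a \<le> s" "s < t" "t \<le> x" "x < b"
        and eq: "(g x - g a) * h s - (h x - h a) * g s = (g x - g a) * h t - (h x - h a) * g t"
      have "h a < h x" using st by (intro pos) auto
      thus "s < xi_fun a h g x" by (rule xi_fun_gt[OF cont_h cont_g diff _ st eq])
    qed (rule pos)
  qed
qed

end
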